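(* Let $n=1$ and $\lambda=\lambda_s=1$. Then the equation $H^{\mathrm o}_\lambda f=0$ has a (nonzero, odd) solution $f$ with $f\in L^\epsilon(\mathbb T)\setminus L^1(\mathbb T)$ for every $0<\epsilon<1$. That is, $0$ is a super-threshold resonance of $H^{\mathrm o}_\lambda$.
   Context: Let $\mathbb T=(-\pi,\pi]$ be the circle with Lebesgue measure and $E(p)=1-\cos p$. For $\lambda\in\mathbb R$, $H^{\mathrm o}_\lambda f=0$ denotes, for a measurable odd function $f$ on $\mathbb T$ with $\sin p\,f(p)$ integrable, the equation $$E(p)f(p)-\frac{\lambda}{2\pi}\sin p\int_{\mathbb T}\sin q\,f(q)\,dq=0\quad\text{for a.e. }p\in\mathbb T .$$ $\lambda_s=\Big(\frac1{2\pi}\int_{\mathbb T}\frac{\sin^2p}{E(p)}dp\Big)^{-1}=1$. $0$ is a (lower) super-threshold resonance of $H^{\mathrm o}_\lambda$ if this equation has a nonzero odd solution $f\notin L^1(\mathbb T)$ with $f\in L^\epsilon(\mathbb T)$ (i.e. $\int_{\mathbb T}|f|^\epsilon<\infty$) for every $0<\epsilon<1$. *)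

theory Defs
  imports "HOL-Analysis.Analysis"
begin

abbreviation torus :: "real measure" where
  "torus \<equiv> lebesgue_on {-pi<..pi}"

(* Inversion of the group R / 2 pi Z, written in the representatives (-pi, pi];
   the point pi is its own inverse. *)
definition torus_neg :: "real \<Rightarrow> real" where
  "torus_neg p = (if p = pi then pi else - p)"

definition odd_on_torus :: "(real \<Rightarrow> complex) \<Rightarrow> bool" where
  "odd_on_torus f \<longleftrightarrow> (\<forall>p\<in>{-pi<..pi}. f (torus_neg p) = - f p)"

(* L^r(T) for every exponent r > 0; for r < 1 it is not a normed space. *)
definition Lspace :: "real \<Rightarrow> (real \<Rightarrow> complex) set" where
  "Lspace r = {f \<in> borel_measurable torus. integrable torus (\<lambda>p. norm (f p) powr r)}"

definition dispersion :: "real \<Rightarrow> real" where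
  "dispersion p = 1 - cos p"

(* The integrand is undefined only at p = 0, a null set. *)
definition lambda_s :: real where
  "lambda_s = inverse (1 / (2 * pi) * (LINT p|torus. (sin p)\<^sup>2 / dispersion p))"

definition H_odd :: "real \<Rightarrow> (real \<Rightarrow> complex) \<Rightarrow> real \<Rightarrow> complex" where
  "H_odd lam f p = of_real (dispersion p) * f p
     - of_real (lam / (2 * pi)) * of_real (sin p) * (LINT q|torus. of_real (sin q) * f q)"

definition H_odd_solution :: "real \<Rightarrow> (real \<Rightarrow> complex) \<Rightarrow> bool" where
  "H_odd_solution lam f \<longleftrightarrow>
     f \<in> borel_measurable torus \<and> odd_on_torus f \<and>
     integrable torus (\<lambda>p. of_real (sin p) * f p) \<and>
     (AE p in torus. H_odd lam f p = 0)"

definition zero_super_threshold_resonance :: "real \<Rightarrow> bool" where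
  "zero_super_threshold_resonance lam \<longleftrightarrow>
     (\<exists>f. H_odd_solution lam f \<and> \<not> (AE p in torus. f p = 0) \<and>
          f \<notin> Lspace 1 \<and> (\<forall>r. 0 < r \<and> r < 1 \<longrightarrow> f \<in> Lspace r))"

end

theory Submission
  imports Defs
begin

text \<open>
  For \<open>\<lambda> = 1\<close> the solution is \<open>f p = sin p / (1 - cos p) = cot (p / 2)\<close>: since
  \<open>sin p * f p = 1 + cos p\<close> almost everywhere, the integral in the equation is \<open>2 * pi\<close> and cancels
  the normalisation.  Near the origin \<open>f\<close> behaves like \<open>2 / p\<close>; the two bounds
  \<open>f p \<ge> 1 / p\<close> on \<open>(0, 1]\<close> and \<open>\<bar>f p\<bar> \<le> 2 / \<bar>p\<bar>\<close> decide integrability of the powers of \<open>\<bar>f\<bar>\<close>.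
\<close>

text \<open>Since \<open>inverse\<close> is positive on \<open>{0<..b}\<close>, its integral there
  would bound \<open>ln b - ln e\<close> for every cutoff \<open>e\<close>, but this grows without
  bound as \<open>e\<close> tends to 0.\<close>

lemma not_integrable_on_inverse_real:
  fixes b :: real
  assumes "0 < b"
  shows "\<not> inverse integrable_on {0<..b}"
proof
  assume int: "inverse integrable_on {0<..b}"
  define I where "I = integral {0<..b} (inverse :: real \<Rightarrow> real)"
  \<comment> \<open>Chosen so that \<open>ln b - ln e\<close> equals
    \<open>\<bar>I\<bar> + 1\<close>, which exceeds \<open>I\<close>.\<close>
  define e where "e = b * exp (- \<bar>I\<bar> - 1)"
  have e: "0 < e" "e \<le> b"
    using assms by (auto simp: e_def mult_le_cancel_left1)
  have "(inverse has_integral ln b - ln e) {e..b}"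
    using e by (intro fundamental_theorem_of_calculus)
      (auto intro!: derivative_eq_intros
        simp: has_real_derivative_iff_has_vector_derivative [symmetric] inverse_eq_divide)
  then have "ln b - ln e \<le> I"
    unfolding I_def using e int
    by (intro has_integral_subset_le [OF _ _ integrable_integral]) auto
  moreover have "ln e = ln b - \<bar>I\<bar> - 1"
    using assms by (simp add: e_def ln_mult)
  ultimately show False by linarith
qed

text \<open>The half \<open>{0..c}\<close> is the standard power integral; the integrand is even, so
  the other half is its mirror image.\<close>

lemma integrable_on_abs_powr:
  fixes a c :: real
  assumes "- 1 < a" "0 \<le> c"
  shows "(\<lambda>x. \<bar>x\<bar> powr a) integrable_on {- c..c}"
proof -
  have pos: "(\<lambda>x. \<bar>x\<bar> powr a) integrable_on {0..c}"
    using integrable_on_powr_from_0 [OF assms] by (rule integrable_eq) auto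
  moreover have "(\<lambda>x. \<bar>x\<bar> powr a) integrable_on {- c..0}"
    using Henstock_Kurzweil_Integration.integrable_reflect_real [THEN iffD2, OF pos]
    by (simp only: abs_minus_cancel minus_zero)
  ultimately show ?thesis
    using assms(2) Henstock_Kurzweil_Integration.integrable_combine [of "- c" 0 c] by simp
qed

lemma cos_eq_1_torus_iff:
  assumes "p \<in> {-pi<..pi}"
  shows "cos p = 1 \<longleftrightarrow> p = 0"
proof
  assume "cos p = 1"
  \<comment> \<open>Evenness moves the argument into \<open>[0, pi]\<close>, where
    \<open>cos\<close> is injective.\<close>
  then have "cos \<bar>p\<bar> = cos 0" by simp
  then show "p = 0"
    using assms cos_inj_pi [of "\<bar>p\<bar>" 0] by auto
qed simp

definition resonance :: "real \<Rightarrow> real" where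
  "resonance p = sin p / dispersion p"

lemma borel_measurable_resonance [measurable]: "resonance \<in> borel_measurable borel"
  unfolding resonance_def dispersion_def by measurable

lemma borel_measurable_torusI:
  "f \<in> borel_measurable borel \<Longrightarrow> f \<in> borel_measurable torus"
  by (intro measurable_restrict_space1 measurable_completion) simp

text \<open>Half-angle formulas. Where \<open>sin (p / 2) = 0\<close>, both sides are 0 because
  division by zero yields 0, so the identity holds at every real \<open>p\<close>.\<close>

lemma resonance_eq_cot: "resonance p = cot (p / 2)"
proof -
  have "sin p = 2 * sin (p / 2) * cos (p / 2)" "dispersion p = 2 * (sin (p / 2))\<^sup>2"
    using sin_double [of "p / 2"] cos_double_sin [of "p / 2"] by (simp_all add: dispersion_def)
  then show ?thesis
    by (simp add: resonance_def cot_def power2_eq_square)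
qed

lemma abs_resonance_le:
  assumes "p \<in> {-pi<..pi}"
  shows "\<bar>resonance p\<bar> \<le> 2 / \<bar>p\<bar>"
\<comment> \<open>At 0 both sides are 0 by the convention for division by zero; at \<open>pi\<close>
  the half angle is a pole of \<open>tan\<close>, but \<open>sin pi = 0\<close>. Elsewhere the bound
  is the reciprocal of \<bar>x\<bar> \<le> \<bar>tan x\<bar> at \<open>p / 2\<close>.\<close>
proof (cases "p = 0 \<or> p = pi")
  case True
  then show ?thesis by (auto simp: resonance_def)
next
  case False
  then have "\<bar>p / 2\<bar> \<le> \<bar>tan (p / 2)\<bar>"
    using assms by (intro abs_tan_ge) auto
  then have "inverse \<bar>tan (p / 2)\<bar> \<le> inverse \<bar>p / 2\<bar>"
    using False by (intro le_imp_inverse_le) auto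
  then show ?thesis
    by (simp add: resonance_eq_cot cot_def tan_def field_simps abs_divide)
qed

text \<open>In the form \<open>(1 + cos p) / sin p\<close> the numerator is at least 1, as
  \<open>cos p\<close> is positive, and the denominator is at most \<open>p\<close>.\<close>

lemma inverse_le_resonance:
  assumes "0 < p" "p \<le> 1"
  shows "inverse p \<le> resonance p"
proof -
  have p: "p < pi / 2"
    using assms pi_gt3 by simp
  have pos: "0 < sin p" "0 < cos p"
    using assms p by (auto intro!: sin_gt_zero cos_gt_zero_pi)
  have ne: "cos p \<noteq> 1"
    using cos_eq_1_torus_iff [of p] assms p by simp
  have "(sin p)\<^sup>2 = (1 - cos p) * (1 + cos p)"
    by (simp add: sin_squared_eq power2_eq_square algebra_simps)
  then have "resonance p = (1 + cos p) / sin p"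
    using ne pos by (simp add: resonance_def dispersion_def field_simps power2_eq_square)
  moreover have "inverse p \<le> inverse (sin p)"
    using assms pos by (intro le_imp_inverse_le sin_x_le_x) auto
  moreover have "inverse (sin p) \<le> (1 + cos p) / sin p"
    using pos by (simp add: field_simps)
  ultimately show ?thesis by simp
qed

text \<open>The origin is the only zero of \<open>dispersion\<close> on the torus, and it is a null
  set; the pointwise identities that follow hold off it.\<close>

lemma AE_torus_nonzero: "AE p in torus. p \<noteq> 0 \<and> p \<in> {-pi<..pi}"
proof -
  have "AE p in lebesgue. p \<noteq> (0::real)"
    by (intro AE_completion AE_lborel_singleton)
  then show ?thesis
    by (subst AE_restrict_space_iff) auto
qed

lemma sin_sq_over_dispersion:
  assumes "p \<noteq> 0" "p \<in> {-pi<..pi}"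
  shows "(sin p)\<^sup>2 / dispersion p = 1 + cos p"
proof -
  have "cos p \<noteq> 1"
    using assms cos_eq_1_torus_iff by blast
  then show ?thesis
    by (simp add: dispersion_def sin_squared_eq power2_eq_square field_simps)
qed

lemma integral_torus_one_plus_cos:
  "integrable torus (\<lambda>p. 1 + cos p)" "(LINT p|torus. 1 + cos p) = 2 * pi"
proof -
  have "(\<lambda>p. 1 + cos p) absolutely_integrable_on {-pi..pi}"
    by (intro absolutely_integrable_continuous_real continuous_intros)
  then have "(\<lambda>p. 1 + cos p) absolutely_integrable_on {-pi<..pi}"
    by (rule set_integrable_subset) auto
  then show int: "integrable torus (\<lambda>p. 1 + cos p)"
    by (simp add: integrable_restrict_space set_integrable_def)
  have "((\<lambda>p. 1 + cos p) has_integral (pi + sin pi) - (- pi + sin (- pi))) {-pi..pi}"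
    by (intro fundamental_theorem_of_calculus)
      (auto intro!: derivative_eq_intros
        simp: has_real_derivative_iff_has_vector_derivative [symmetric])
  then have "((\<lambda>p. 1 + cos p) has_integral 2 * pi) {-pi<..pi}"
    by (subst has_integral_spike_set_eq [where T = "{-pi..pi}"])
      (auto intro: negligible_subset [of "{-pi}"])
  then show "(LINT p|torus. 1 + cos p) = 2 * pi"
    using lebesgue_integral_eq_integral [OF int] by (simp add: integral_unique)
qed

lemma lambda_s_eq_1: "lambda_s = 1"
proof -
  have "(LINT p|torus. (sin p)\<^sup>2 / dispersion p) = (LINT p|torus. 1 + cos p)"
  proof (rule integral_cong_AE)
    show "AE p in torus. (sin p)\<^sup>2 / dispersion p = 1 + cos p"
      using AE_torus_nonzero by eventually_elim (rule sin_sq_over_dispersion; simp)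
    have "(\<lambda>p. sin p * resonance p) \<in> borel_measurable torus"
      by (intro borel_measurable_torusI) measurable
    then show "(\<lambda>p. (sin p)\<^sup>2 / dispersion p) \<in> borel_measurable torus"
      by (simp add: resonance_def power2_eq_square)
  qed (use integral_torus_one_plus_cos in auto)
  then show ?thesis
    by (simp add: lambda_s_def integral_torus_one_plus_cos)
qed

lemma resonance_H_odd_solution: "H_odd_solution 1 (\<lambda>p. of_real (resonance p))"
proof -
  have meas: "(\<lambda>p. complex_of_real (sin p) * of_real (resonance p)) \<in> borel_measurable torus"
    by (intro borel_measurable_torusI) measurable
  have int: "integrable torus (\<lambda>p. complex_of_real (1 + cos p))"
    using integral_torus_one_plus_cos(1) by (rule integrable_of_real)
  have ae: "AE p in torus. complex_of_real (sin p) * of_real (resonance p) = of_real (1 + cos p)"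
    using AE_torus_nonzero
  proof eventually_elim
    case (elim p)
    then have "sin p * resonance p = 1 + cos p"
      using sin_sq_over_dispersion [of p] by (simp add: resonance_def power2_eq_square)
    then show ?case by (metis of_real_mult)
  qed
  have "(LINT q|torus. complex_of_real (sin q) * of_real (resonance q))
      = (LINT q|torus. complex_of_real (1 + cos q))"
    using ae meas int by (intro integral_cong_AE) auto
  also have "\<dots> = of_real (2 * pi)"
    using integral_torus_one_plus_cos(2) integral_complex_of_real by metis
  finally have eq: "(LINT q|torus. complex_of_real (sin q) * of_real (resonance q)) = of_real (2 * pi)" .
  \<comment> \<open>The integral cancels the factor \<open>1 / (2 * pi)\<close>, which leaves
    \<open>dispersion p * resonance p = sin p\<close>.\<close>
  have "AE p in torus. H_odd 1 (\<lambda>p. of_real (resonance p)) p = 0"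
    using AE_torus_nonzero
  proof eventually_elim
    case (elim p)
    then have "dispersion p \<noteq> 0"
      using cos_eq_1_torus_iff [of p] by (auto simp: dispersion_def)
    then show ?case
      unfolding H_odd_def eq by (simp add: resonance_def)
  qed
  moreover have "integrable torus (\<lambda>p. complex_of_real (sin p) * of_real (resonance p))"
    using integrable_cong_AE [OF meas _ ae] int by auto
  \<comment> \<open>At the self-inverse points 0 and \<open>pi\<close> oddness forces the value 0,
    which \<open>sin\<close> supplies.\<close>
  moreover have "odd_on_torus (\<lambda>p. of_real (resonance p))"
    by (auto simp: odd_on_torus_def torus_neg_def resonance_def dispersion_def)
  ultimately show ?thesis
    by (auto simp: H_odd_solution_def intro: borel_measurable_torusI)
qed

text \<open>Integrability would pass from \<open>resonance\<close> to the smaller function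
  \<open>inverse\<close> on \<open>{0<..1}\<close>, whose integral diverges logarithmically.\<close>

lemma resonance_notin_L1: "(\<lambda>p. of_real (resonance p)) \<notin> Lspace 1"
proof
  assume "(\<lambda>p. of_real (resonance p)) \<in> Lspace 1"
  then have "integrable torus (\<lambda>p. \<bar>resonance p\<bar>)"
    by (simp add: Lspace_def)
  then have "(\<lambda>p. \<bar>resonance p\<bar>) absolutely_integrable_on {-pi<..pi}"
    by (simp add: integrable_restrict_space set_integrable_def)
  then have "(\<lambda>p. \<bar>resonance p\<bar>) absolutely_integrable_on {0<..1}"
    using pi_gt3 by (elim set_integrable_subset) auto
  then have "(\<lambda>p. \<bar>resonance p\<bar>) integrable_on {0<..1}"
    using absolutely_integrable_on_def by blast
  moreover have "(inverse :: real \<Rightarrow> real) \<in> borel_measurable (lebesgue_on {0<..1})"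
    by (intro measurable_restrict_space1 measurable_completion) simp
  moreover have "norm (inverse p) \<le> \<bar>resonance p\<bar>" if "p \<in> {0<..1}" for p :: real
    using inverse_le_resonance [of p] that by simp
  ultimately have "(inverse :: real \<Rightarrow> real) integrable_on {0<..1}"
    using measurable_bounded_by_integrable_imp_integrable
      [of inverse "{0<..1}" "\<lambda>p. \<bar>resonance p\<bar>"] by auto
  then show False
    using not_integrable_on_inverse_real by simp
qed

lemma resonance_in_Lspace:
  assumes "0 < r" "r < 1"
  shows "(\<lambda>p. of_real (resonance p)) \<in> Lspace r"
proof -
  \<comment> \<open>Here \<open>r < 1\<close> enters: the exponent \<open>- r\<close> stays above
    -1.\<close>
  have "(\<lambda>p. \<bar>p\<bar> powr - r) absolutely_integrable_on {-pi..pi}"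
    using assms by (intro nonnegative_absolutely_integrable_1 integrable_on_abs_powr) auto
  then have "(\<lambda>p. \<bar>p\<bar> powr - r) absolutely_integrable_on {-pi<..pi}"
    by (rule set_integrable_subset) auto
  then have "integrable torus (\<lambda>p. \<bar>p\<bar> powr - r)"
    by (simp add: integrable_restrict_space set_integrable_def)
  \<comment> \<open>This majorant is the \<open>r\<close>-th power of the bound
    \<open>2 / \<bar>p\<bar>\<close>.\<close>
  then have "integrable torus (\<lambda>p. 2 powr r * \<bar>p\<bar> powr - r)"
    by simp
  moreover have "(\<lambda>p. \<bar>resonance p\<bar> powr r) \<in> borel_measurable torus"
    by (intro borel_measurable_torusI) measurable
  moreover have "AE p in torus. norm (\<bar>resonance p\<bar> powr r) \<le> norm (2 powr r * \<bar>p\<bar> powr - r)"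
    using AE_torus_nonzero
  proof eventually_elim
    case (elim p)
    then have "\<bar>resonance p\<bar> powr r \<le> (2 / \<bar>p\<bar>) powr r"
      using assms abs_resonance_le by (intro powr_mono2) auto
    then show ?case
      by (simp add: powr_divide powr_minus_divide)
  qed
  ultimately have "integrable torus (\<lambda>p. \<bar>resonance p\<bar> powr r)"
    by (rule Bochner_Integration.integrable_bound)
  then show ?thesis
    by (auto simp: Lspace_def intro: borel_measurable_torusI)
qed

text \<open>Applied contrapositively: a function outside \<open>Lspace 1\<close> cannot vanish
  almost everywhere, so non-integrability of \<open>resonance\<close> also makes it a nonzero
  solution.\<close>

lemma AE_zero_imp_in_Lspace:
  assumes "f \<in> borel_measurable torus" "AE p in torus. f p = 0"
  shows "f \<in> Lspace r"
proof -
  have "integrable torus (\<lambda>p. norm (f p) powr r) = integrable torus (\<lambda>p. 0 :: real)"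
    using assms by (intro integrable_cong_AE) auto
  then show ?thesis
    using assms(1) by (simp add: Lspace_def)
qed

theorem proposition4p7:
  fixes lam :: real
  assumes "lam = lambda_s"
  shows "lambda_s = 1 \<and> zero_super_threshold_resonance lam"
proof -
  have "\<not> (AE p in torus. complex_of_real (resonance p) = 0)"
    using AE_zero_imp_in_Lspace [of "\<lambda>p. of_real (resonance p)" 1] resonance_notin_L1
      resonance_H_odd_solution H_odd_solution_def by blast
  then have "zero_super_threshold_resonance 1"
    unfolding zero_super_threshold_resonance_def
    using resonance_H_odd_solution resonance_notin_L1 resonance_in_Lspace by blast
  then show ?thesis
    using assms lambda_s_eq_1 by simp
qed

end
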